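(* Let $A \in \mathbb{R}^{n\times n}$, $B\in\mathbb{R}^{n\times m}$, $C\in\mathbb{R}^{p\times n}$, and consider the deterministic linear system $x_{k+1}=Ax_k+Bu_k$, $y_k=Cx_k$, with constant reference $r_k = r_{ss}\in\mathbb{R}^p$. Let $Q\in\mathbb{R}^{p\times p}$ and $R\in\mathbb{R}^{m\times m}$ be positive definite. Assume that the pair $(A,\sqrt{Q}\,C)$ is observable and the pair $(A,B)$ is controllable. Let $(x_{ss},u_{ss})$ be a steady-state pair satisfying $$\begin{bmatrix} A-I & B\\ C & \mathbf{0}\end{bmatrix}\begin{bmatrix} x_{ss}\\ u_{ss}\end{bmatrix}=\begin{bmatrix}\mathbf{0}\\ r_{ss}\end{bmatrix},$$ and define the deviation variables $\tilde x_k=x_k-x_{ss}$, $\tilde u_k=u_k-u_{ss}$ (so that $\tilde x_{k+1}=A\tilde x_k+B\tilde u_k$). Define the stage cost $C(x_k,u_k)=x_k^\top C^\top Q C x_k+u_k^\top R u_k$, the steady-state cost $C_{ss}=x_{ss}^\top C^\top QC x_{ss}+u_{ss}^\top R u_{ss}$, and the cost index $$J(\tilde x_0)=\sum_{k=0}^\infty \left|C(x_k,u_k)-C_{ss}\right|.$$ Then there exists a value function $V(\tilde x_k)$ (namely the optimal cost $V(\tilde x_0)=\inf_{\{\tilde u_k\}} J(\tilde x_0)$, which is finite for all $\tilde x_0$) that satisfies the Bellman equation $$V(\tilde x_k)=\min_{\{u_k\}_{k=0}^\infty}\left\{\left|C(x_k,u_k)-C_{ss}\right|+V(\tilde x_{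k+1})\right\}.$$
   Context: This is an average-reward/cost formulation of optimal tracking control: the term $C_{ss}$ plays the role of the average cost, subtracted from the stage cost so that the infinite-horizon sum can be finite even though $u_k$ converges to a nonzero steady-state value $u_{ss}$. $I$ and $\mathbf{0}$ denote identity and zero matrices of appropriate dimensions. *)

theory Defs
  imports "HOL-Analysis.Analysis"
begin

text \<open>Symmetric positive definite matrix.\<close>
definition pos_def_mat :: "real^'n^'n \<Rightarrow> bool" where
  "pos_def_mat M \<longleftrightarrow> transpose M = M \<and> (\<forall>x. x \<noteq> 0 \<longrightarrow> x \<bullet> (M *v x) > 0)"

text \<open>Symmetric positive semidefinite matrix.\<close>
definition pos_semidef_mat :: "real^'n^'n \<Rightarrow> bool" where
  "pos_semidef_mat M \<longleftrightarrow> transpose M = M \<and> (\<forall>x. x \<bullet> (M *v x) \<ge> 0)"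

text \<open>The (principal) matrix square root: the unique symmetric PSD S with S S = M.\<close>
definition msqrt :: "real^'n^'n \<Rightarrow> real^'n^'n" where
  "msqrt M = (THE S. pos_semidef_mat S \<and> S ** S = M)"

text \<open>State trajectory of x(k+1) = A x(k) + B u(k).\<close>
fun traj :: "real^'n^'n \<Rightarrow> real^'m^'n \<Rightarrow> real^'n \<Rightarrow> (nat \<Rightarrow> real^'m) \<Rightarrow> nat \<Rightarrow> real^'n" where
  "traj A B x0 u 0 = x0"
| "traj A B x0 u (Suc k) = A *v traj A B x0 u k + B *v u k"

text \<open>Controllability: every state can be steered to every state in finitely many steps.\<close>
definition controllable :: "real^'n^'n \<Rightarrow> real^'m^'n \<Rightarrow> bool" where
  "controllable A B \<longleftrightarrow> (\<forall>x0 x1. \<exists>u N. traj A B x0 u N = x1)"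

text \<open>Observability of (A, C): the initial state is determined by the output
  sequence y_k = C A^k x_0 of the autonomous system.\<close>
definition observable :: "real^'n^'n \<Rightarrow> real^'n^'p \<Rightarrow> bool" where
  "observable A C \<longleftrightarrow>
     (\<forall>x0 x0'. (\<forall>k. C *v (((*v) A ^^ k) x0) = C *v (((*v) A ^^ k) x0')) \<longrightarrow> x0 = x0')"

text \<open>Stage cost C(x,u) = x' C' Q C x + u' R u.\<close>
definition stage_cost :: "real^'n^'p \<Rightarrow> real^'p^'p \<Rightarrow> real^'m^'m \<Rightarrow> real^'n \<Rightarrow> real^'m \<Rightarrow> real" where
  "stage_cost C Q R x u = (C *v x) \<bullet> (Q *v (C *v x)) + u \<bullet> (R *v u)"

text \<open>Cost index J(x~0) for deviation input sequence u~, as an extended nonnegative real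
  (the series of nonnegative terms may diverge).\<close>
definition cost_index ::
  "real^'n^'n \<Rightarrow> real^'m^'n \<Rightarrow> real^'n^'p \<Rightarrow> real^'p^'p \<Rightarrow> real^'m^'m \<Rightarrow> real^'n \<Rightarrow> real^'m
    \<Rightarrow> real^'n \<Rightarrow> (nat \<Rightarrow> real^'m) \<Rightarrow> ennreal" where
  "cost_index A B C Q R xss uss xt0 ut =
     (\<Sum>k. ennreal \<bar>stage_cost C Q R (traj A B xt0 ut k + xss) (ut k + uss)
                     - stage_cost C Q R xss uss\<bar>)"

text \<open>Optimal cost V(x~0) = inf over deviation input sequences of J(x~0).\<close>
definition value_fun ::
  "real^'n^'n \<Rightarrow> real^'m^'n \<Rightarrow> real^'n^'p \<Rightarrow> real^'p^'p \<Rightarrow> real^'m^'m \<Rightarrow> real^'n \<Rightarrow> real^'m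
    \<Rightarrow> real^'n \<Rightarrow> ennreal" where
  "value_fun A B C Q R xss uss xt0 = (INF ut. cost_index A B C Q R xss uss xt0 ut)"

end

(*
  Splitting off the first step of an input sequence gives the dynamic programming inequality
  V x \<le> l x v + V (A x + B v) for the optimal cost V of any running cost l.  V is finite because
  controllability steers every deviation state to the origin in finitely many steps, where the
  zero deviation input keeps the cost at zero.  Equality in the Bellman equation follows once
  the infimum defining V is attained: along a minimizing sequence each stage cost is bounded, so
  positive definiteness of R confines all inputs to a fixed ball; by Tychonoff a subsequence
  converges pointwise, and the total cost, a supremum of continuous partial sums, is lower
  semicontinuous under pointwise convergence.  The first step of an optimal input then attains
  the minimum.
*)

theory Submission
  imports Defs
begin

lemma pos_def_mat_quadratic_form_nonneg:
  assumes "pos_def_mat Q"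
  shows "0 \<le> y \<bullet> (Q *v y)"
  using assms unfolding pos_def_mat_def by (cases "y = 0") (auto intro: less_imp_le)

lemma pos_def_mat_quadratic_form_ge:
  fixes R :: "real^'m^'m"
  assumes "pos_def_mat R"
  obtains c where "c > 0" and "\<And>w. c * (norm w)\<^sup>2 \<le> w \<bullet> (R *v w)"
proof -
  have "continuous_on (sphere 0 1) (\<lambda>w. w \<bullet> (R *v w))"
    by (intro continuous_intros)
  moreover have "sphere (0::real^'m) 1 \<noteq> {}"
    by simp
  ultimately obtain w0 where w0: "w0 \<in> sphere 0 1"
    and min: "\<And>y. y \<in> sphere 0 1 \<Longrightarrow> w0 \<bullet> (R *v w0) \<le> y \<bullet> (R *v y)"
    using continuous_attains_inf[OF compact_sphere] by blast
  define c where "c = w0 \<bullet> (R *v w0)"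
  have "w0 \<noteq> 0"
    using w0 by auto
  then have "c > 0"
    using assms unfolding pos_def_mat_def c_def by blast
  moreover have "c * (norm w)\<^sup>2 \<le> w \<bullet> (R *v w)" for w
  proof (cases "w = 0")
    case False
    define y where "y = (1 / norm w) *\<^sub>R w"
    have "c \<le> y \<bullet> (R *v y)"
      using min[of y] False by (simp add: c_def y_def)
    also have "\<dots> = (1 / norm w)\<^sup>2 * (w \<bullet> (R *v w))"
      by (simp add: y_def matrix_vector_mult_scaleR power2_eq_square)
    finally have "c * (norm w)\<^sup>2 \<le> (1 / norm w)\<^sup>2 * (w \<bullet> (R *v w)) * (norm w)\<^sup>2"
      by (simp add: mult_right_mono)
    also have "\<dots> = w \<bullet> (R *v w)"
      using False by (simp add: field_simps)
    finally show ?thesis .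
  qed simp
  ultimately show thesis by (rule that)
qed

lemma compact_imp_pointwise_convergent_subseq:
  fixes v :: "nat \<Rightarrow> nat \<Rightarrow> 'a::metric_space"
  assumes "compact S" and "\<And>j k. v j k \<in> S"
  obtains r u where "strict_mono r" and "\<And>k. (\<lambda>j. v (r j) k) \<longlonglongrightarrow> u k"
proof -
  have "compact (PiE UNIV (\<lambda>_::nat. S))"
    using compactin_PiE[of "\<lambda>_. euclidean" UNIV "\<lambda>_. S"] assms(1)
    by (simp add: euclidean_product_topology)
  moreover have "v j \<in> PiE UNIV (\<lambda>_. S)" for j
    using assms(2) by (auto simp: PiE_iff)
  \<comment> \<open>the product topology on \<open>nat \<Rightarrow> 'a\<close> is metrizable, so compactness is sequential\<close>
  ultimately obtain u r where r: "strict_mono r" and "(v \<circ> r) \<longlonglongrightarrow> u"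
    using compact_imp_seq_compact seq_compactE by metis
  moreover have "isCont (\<lambda>f. f k) u" for k :: nat
    by (metis continuous_on_product_coordinates continuous_on_eq_continuous_at open_UNIV UNIV_I)
  ultimately have "(\<lambda>j. v (r j) k) \<longlonglongrightarrow> u k" for k
    using isCont_tendsto_compose[of u "\<lambda>f. f k"] by (auto simp: comp_def)
  with r show thesis by (rule that)
qed

lemma ennreal_add_INF: "(c::ennreal) + (INF i. f i) = (INF i. c + f i)"
  using continuous_at_Inf_mono[of "\<lambda>x. c + x" "range f"]
  using continuous_add[of "at_right (Inf (range f))" "\<lambda>x. c" "\<lambda>x. x"]
  by (auto simp: mono_def image_comp)

lemma traj_Suc_shift:
  "traj A B x u (Suc k) = traj A B (A *v x + B *v u 0) (\<lambda>k. u (Suc k)) k"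
  by (induction k) auto

lemma traj_zero: "traj A B 0 (\<lambda>_. 0) k = 0"
  by (induction k) auto

lemma tendsto_traj:
  assumes "\<And>k. (\<lambda>j. v j k) \<longlonglongrightarrow> u k"
  shows "(\<lambda>j. traj A B x (v j) k) \<longlonglongrightarrow> traj A B x u k"
  using assms
  by (induction k) (auto intro!: tendsto_intros bounded_linear.tendsto[OF matrix_vector_mul_bounded_linear])

definition total_cost ::
  "(real^'n \<Rightarrow> real^'m \<Rightarrow> real) \<Rightarrow> real^'n^'n \<Rightarrow> real^'m^'n \<Rightarrow> real^'n \<Rightarrow> (nat \<Rightarrow> real^'m) \<Rightarrow> ennreal"
  where "total_cost l A B x u = (\<Sum>k. ennreal (l (traj A B x u k) (u k)))"

definition optimal_cost ::
  "(real^'n \<Rightarrow> real^'m \<Rightarrow> real) \<Rightarrow> real^'n^'n \<Rightarrow> real^'m^'n \<Rightarrow> real^'n \<Rightarrow> ennreal"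
  where "optimal_cost l A B x = (INF u. total_cost l A B x u)"

lemma optimal_cost_le_total_cost: "optimal_cost l A B x \<le> total_cost l A B x u"
  unfolding optimal_cost_def by (rule INF_lower) simp

lemma total_cost_split_head:
  "total_cost l A B x u = ennreal (l x (u 0)) + total_cost l A B (A *v x + B *v u 0) (\<lambda>k. u (Suc k))"
  unfolding total_cost_def
  using suminf_offset[of "\<lambda>k. ennreal (l (traj A B x u k) (u k))" 1]
  by (simp del: traj.simps(2) add: traj_Suc_shift add.commute)

lemma optimal_cost_le_Bellman:
  "optimal_cost l A B x \<le> ennreal (l x v) + optimal_cost l A B (A *v x + B *v v)"
proof -
  have "optimal_cost l A B x \<le> ennreal (l x v) + total_cost l A B (A *v x + B *v v) u" for u
    using optimal_cost_le_total_cost[of l A B x "case_nat v u"]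
      total_cost_split_head[of l A B x "case_nat v u"]
    by simp
  then show ?thesis
    unfolding optimal_cost_def[of l A B "A *v x + B *v v"] ennreal_add_INF
    by (rule INF_greatest)
qed

lemma optimal_cost_le_prefix:
  "optimal_cost l A B x
     \<le> (\<Sum>k<N. ennreal (l (traj A B x u k) (u k))) + optimal_cost l A B (traj A B x u N)"
proof (induction N arbitrary: x u)
  case (Suc N)
  let ?x1 = "A *v x + B *v u 0" and ?u1 = "\<lambda>k. u (Suc k)"
  have "optimal_cost l A B x \<le> ennreal (l x (u 0)) + optimal_cost l A B ?x1"
    by (rule optimal_cost_le_Bellman)
  also have "\<dots> \<le> ennreal (l x (u 0))
      + ((\<Sum>k<N. ennreal (l (traj A B ?x1 ?u1 k) (?u1 k))) + optimal_cost l A B (traj A B ?x1 ?u1 N))"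
    using Suc.IH by (rule add_left_mono)
  also have "\<dots> = (\<Sum>k<Suc N. ennreal (l (traj A B x u k) (u k))) + optimal_cost l A B (traj A B x u (Suc N))"
    by (simp del: traj.simps(2) sum.lessThan_Suc add: sum.lessThan_Suc_shift traj_Suc_shift add.assoc)
  finally show ?case .
qed simp

lemma optimal_cost_finite:
  assumes "controllable A B" and "l 0 0 = 0"
  shows "optimal_cost l A B x < top"
proof -
  obtain u N where steer: "traj A B x u N = 0"
    using assms(1) unfolding controllable_def by blast
  have "optimal_cost l A B 0 \<le> total_cost l A B 0 (\<lambda>_. 0)"
    by (rule optimal_cost_le_total_cost)
  also have "\<dots> = 0"
    by (simp add: total_cost_def traj_zero assms(2))
  finally have "optimal_cost l A B x \<le> (\<Sum>k<N. ennreal (l (traj A B x u k) (u k)))"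
    using optimal_cost_le_prefix[of l A B x u N] steer by simp
  also have "\<dots> < top"
    by (simp add: less_top[symmetric])
  finally show ?thesis .
qed

lemma total_cost_le_of_pointwise_tendsto:
  assumes cont: "continuous_on UNIV (\<lambda>(x, u). l x u)"
    and conv: "\<And>k. (\<lambda>j. v j k) \<longlonglongrightarrow> u k"
    and lim: "(\<lambda>j. total_cost l A B x (v j)) \<longlonglongrightarrow> c"
  shows "total_cost l A B x u \<le> c"
proof -
  have "(\<lambda>j. l (traj A B x (v j) k) (v j k)) \<longlonglongrightarrow> l (traj A B x u k) (u k)" for k
  proof -
    have "isCont (\<lambda>(x, u). l x u) (traj A B x u k, u k)"
      using cont by (simp add: continuous_on_eq_continuous_at)
    moreover have "(\<lambda>j. (traj A B x (v j) k, v j k)) \<longlonglongrightarrow> (traj A B x u k, u k)"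
      by (intro tendsto_Pair tendsto_traj conv)
    ultimately show ?thesis
      using isCont_tendsto_compose by fastforce
  qed
  then have "(\<lambda>j. \<Sum>k<n. ennreal (l (traj A B x (v j) k) (v j k)))
      \<longlonglongrightarrow> (\<Sum>k<n. ennreal (l (traj A B x u k) (u k)))" for n
    by (intro tendsto_sum tendsto_ennrealI)
  then have "(\<Sum>k<n. ennreal (l (traj A B x u k) (u k))) \<le> c" for n
    using lim by (rule LIMSEQ_le) (auto simp: total_cost_def intro!: sum_le_suminf summableI)
  then show ?thesis
    unfolding total_cost_def by (intro suminf_le_const summableI)
qed

lemma optimal_input_exists:
  assumes cont: "continuous_on UNIV (\<lambda>(x, u). l x u)"
    and coercive: "\<And>b. \<exists>K. \<forall>x u. l x u \<le> b \<longrightarrow> norm u \<le> K"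
    and finite_cost: "optimal_cost l A B x < top"
  obtains u where "total_cost l A B x u = optimal_cost l A B x"
proof -
  let ?J = "total_cost l A B x" and ?V = "optimal_cost l A B x"
  obtain f where f_range: "\<And>j. f j \<in> range ?J" and f_lim: "f \<longlonglongrightarrow> ?V"
    using Inf_as_limit[of "range ?J"] unfolding optimal_cost_def by auto
  define v where "v j = inv_into UNIV ?J (f j)" for j
  have "f = (\<lambda>j. ?J (v j))"
    unfolding v_def using f_range by (simp add: fun_eq_iff f_inv_into_f)
  with f_lim have v_lim: "(\<lambda>j. ?J (v j)) \<longlonglongrightarrow> ?V"
    by simp
  define b where "b = enn2real ?V + 1"
  have b_pos: "b > 0"
    unfolding b_def by (simp add: add_nonneg_pos)
  have "?V = ennreal (enn2real ?V)"
    using finite_cost by simp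
  also have "\<dots> < ennreal b"
    using b_pos by (intro ennreal_lessI) (simp_all add: b_def)
  finally have "?V < ennreal b" .
  then obtain N where N: "\<And>j. j \<ge> N \<Longrightarrow> ?J (v j) < ennreal b"
    using order_tendstoD(2)[OF v_lim] by (auto simp: eventually_sequentially)
  \<comment> \<open>beyond \<open>N\<close> the minimizing sequence has uniformly bounded cost, hence bounded inputs\<close>
  define w where "w j = v (j + N)" for j
  have w_lim: "(\<lambda>j. ?J (w j)) \<longlonglongrightarrow> ?V"
    unfolding w_def using LIMSEQ_ignore_initial_segment[OF v_lim] .
  have cost_le: "l (traj A B x (w j) k) (w j k) \<le> b" for j k
  proof -
    have "ennreal (l (traj A B x (w j) k) (w j k)) = (\<Sum>i\<in>{k}. ennreal (l (traj A B x (w j) i) (w j i)))"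
      by simp
    also have "\<dots> \<le> ?J (w j)"
      unfolding total_cost_def by (intro sum_le_suminf summableI) auto
    also have "\<dots> < ennreal b"
      using N by (simp add: w_def)
    finally have "ennreal (l (traj A B x (w j) k) (w j k)) \<le> ennreal b"
      by (rule less_imp_le)
    then show ?thesis
      using b_pos by (simp add: ennreal_le_iff2)
  qed
  obtain K where K: "\<And>x u. l x u \<le> b \<Longrightarrow> norm u \<le> K"
    using coercive by blast
  have "w j k \<in> cball 0 K" for j k
    using K[OF cost_le] by simp
  then obtain r u where r: "strict_mono r" and conv: "\<And>k. (\<lambda>j. w (r j) k) \<longlonglongrightarrow> u k"
    using compact_imp_pointwise_convergent_subseq[OF compact_cball] by metis
  have "(\<lambda>j. ?J (w (r j))) \<longlonglongrightarrow> ?V"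
    using LIMSEQ_subseq_LIMSEQ[OF w_lim r] by (simp add: comp_def)
  then have "?J u \<le> ?V"
    by (rule total_cost_le_of_pointwise_tendsto[OF cont conv])
  then show thesis
    using optimal_cost_le_total_cost[of l A B x u] by (intro that) (rule antisym)
qed

lemma optimal_cost_eq_Bellman:
  assumes "total_cost l A B x u = optimal_cost l A B x"
  shows "optimal_cost l A B x = ennreal (l x (u 0)) + optimal_cost l A B (A *v x + B *v u 0)"
proof (rule antisym)
  have "ennreal (l x (u 0)) + optimal_cost l A B (A *v x + B *v u 0)
      \<le> ennreal (l x (u 0)) + total_cost l A B (A *v x + B *v u 0) (\<lambda>k. u (Suc k))"
    by (intro add_left_mono optimal_cost_le_total_cost)
  also have "\<dots> = optimal_cost l A B x"
    using assms total_cost_split_head[of l A B x u] by simp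
  finally show "ennreal (l x (u 0)) + optimal_cost l A B (A *v x + B *v u 0) \<le> optimal_cost l A B x" .
qed (rule optimal_cost_le_Bellman)

definition deviation_cost ::
  "real^'n^'p \<Rightarrow> real^'p^'p \<Rightarrow> real^'m^'m \<Rightarrow> real^'n \<Rightarrow> real^'m \<Rightarrow> real^'n \<Rightarrow> real^'m \<Rightarrow> real"
  where "deviation_cost C Q R xss uss x u =
    \<bar>stage_cost C Q R (x + xss) (u + uss) - stage_cost C Q R xss uss\<bar>"

lemma value_fun_eq_optimal_cost:
  "value_fun A B C Q R xss uss = optimal_cost (deviation_cost C Q R xss uss) A B"
  unfolding fun_eq_iff value_fun_def optimal_cost_def cost_index_def total_cost_def deviation_cost_def
  by (intro allI refl)

lemma continuous_on_deviation_cost: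
  "continuous_on UNIV (\<lambda>(x, u). deviation_cost C Q R xss uss x u)"
  unfolding deviation_cost_def stage_cost_def case_prod_unfold
  by (intro continuous_intros bounded_linear.continuous_on[OF matrix_vector_mul_bounded_linear])

lemma deviation_cost_sublevel_bounded:
  assumes "pos_def_mat Q" and "pos_def_mat R"
  shows "\<exists>K. \<forall>x u. deviation_cost C Q R xss uss x u \<le> b \<longrightarrow> norm u \<le> K"
proof -
  obtain c where c: "c > 0" "\<And>w. c * (norm w)\<^sup>2 \<le> w \<bullet> (R *v w)"
    using pos_def_mat_quadratic_form_ge[OF assms(2)] by blast
  define K where "K = sqrt ((b + stage_cost C Q R xss uss) / c) + norm uss"
  have "norm u \<le> K" if "deviation_cost C Q R xss uss x u \<le> b" for x u
  proof -
    have "c * (norm (u + uss))\<^sup>2 \<le> b + stage_cost C Q R xss uss"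
      using that c(2)[of "u + uss"] pos_def_mat_quadratic_form_nonneg[OF assms(1), of "C *v (x + xss)"]
      unfolding deviation_cost_def stage_cost_def by (simp add: abs_le_iff)
    then have "norm (u + uss) \<le> sqrt ((b + stage_cost C Q R xss uss) / c)"
      using c(1) by (simp add: real_le_rsqrt field_simps)
    moreover have "norm u \<le> norm (u + uss) + norm uss"
      using norm_triangle_ineq4[of "u + uss" uss] by (simp only: add_diff_cancel_right')
    ultimately show ?thesis
      unfolding K_def by linarith
  qed
  then show ?thesis by blast
qed

theorem lemma1:
  fixes A :: "real^'n^'n" and B :: "real^'m^'n" and C :: "real^'n^'p"
    and Q :: "real^'p^'p" and R :: "real^'m^'m"
    and rss :: "real^'p" and xss :: "real^'n" and uss :: "real^'m"
  assumes "pos_def_mat Q" and "pos_def_mat R"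
    and "observable A (msqrt Q ** C)"
    and "controllable A B"
    and "(A - mat 1) *v xss + B *v uss = 0"
    and "C *v xss = rss"
  shows "(\<forall>xt. value_fun A B C Q R xss uss xt < top) \<and>
         (\<forall>xt.
            (\<forall>ut. value_fun A B C Q R xss uss xt
                   \<le> ennreal \<bar>stage_cost C Q R (xt + xss) (ut + uss) - stage_cost C Q R xss uss\<bar>
                     + value_fun A B C Q R xss uss (A *v xt + B *v ut)) \<and>
            (\<exists>ut. value_fun A B C Q R xss uss xt
                   = ennreal \<bar>stage_cost C Q R (xt + xss) (ut + uss) - stage_cost C Q R xss uss\<bar>
                     + value_fun A B C Q R xss uss (A *v xt + B *v ut)))"
proof -
  let ?l = "deviation_cost C Q R xss uss"
  have finite_cost: "optimal_cost ?l A B x < top" for x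
    using assms(4) by (rule optimal_cost_finite) (simp add: deviation_cost_def)
  have "\<exists>v. optimal_cost ?l A B x = ennreal (?l x v) + optimal_cost ?l A B (A *v x + B *v v)" for x
  proof -
    obtain u where "total_cost ?l A B x u = optimal_cost ?l A B x"
      using optimal_input_exists[OF continuous_on_deviation_cost
          deviation_cost_sublevel_bounded[OF assms(1,2)] finite_cost] .
    then show ?thesis
      by (blast dest: optimal_cost_eq_Bellman)
  qed
  then show ?thesis
    using finite_cost optimal_cost_le_Bellman[of ?l A B]
    unfolding value_fun_eq_optimal_cost deviation_cost_def[symmetric] by blast
qed

end
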